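(* Let $n$ be a positive integer. The quadratic unitary Cayley graph $G_n$ admits perfect state transfer if and only if $n=2$ or $n=4$.
   Context: The quadratic unitary Cayley graph $G_n$ is the simple undirected graph with vertex set $\mathbb{Z}_n$ in which two distinct vertices $a,b$ are adjacent if and only if $a-b\equiv u^2$ or $a-b\equiv -u^2 \pmod n$ for some integer $u$ with $1\le u\le n-1$ and $\gcd(u,n)=1$. For a finite simple undirected graph $\Gamma$ with adjacency matrix $A$, the transition matrix is $H(t)=\exp(-\mathbf{i}tA)$, $t\in\mathbb{R}$, where $\mathbf{i}=\sqrt{-1}$. For a vertex $a$, $\mathbf{e}_a$ is the standard basis column vector indexed by the vertices with entry $1$ at $a$ and $0$ elsewhere. $\Gamma$ admits perfect state transfer (PST) from a vertex $a$ to another vertex $b\neq a$ if there is a real number $t>0$ such that $H(t)\mathbf{e}_a=\beta\mathbf{e}_b$ for some complex number $\beta$ with $|\beta|=1$. $\Gamma$ admits PST if it does so from some vertex $a$ to some other vertex $b$. *)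

theory Defs
  imports
    "HOL-Number_Theory.Cong"
    "Jordan_Normal_Form.Jordan_Normal_Form"
begin

(* A finite simple graph on n vertices is given by n and an adjacency relation on the vertex
   set {0..<n}; values of the relation outside {0..<n} are irrelevant. *)

definition adj_mat :: "nat \<Rightarrow> (nat \<Rightarrow> nat \<Rightarrow> bool) \<Rightarrow> complex mat" where
  "adj_mat n E = mat n n (\<lambda>(a, b). if E a b then 1 else 0)"

(* The exponential series of a square matrix, summed entrywise; every entry converges, see
   mat_exp_summable below. *)
definition mat_exp :: "complex mat \<Rightarrow> complex mat" where
  "mat_exp A = mat (dim_row A) (dim_row A) (\<lambda>(i, j). \<Sum>k. (A ^\<^sub>m k) $$ (i, j) / fact k)"

definition transition_mat :: "nat \<Rightarrow> (nat \<Rightarrow> nat \<Rightarrow> bool) \<Rightarrow> real \<Rightarrow> complex mat" where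
  "transition_mat n E t = mat_exp ((- \<i> * complex_of_real t) \<cdot>\<^sub>m adj_mat n E)"

definition pst_between :: "nat \<Rightarrow> (nat \<Rightarrow> nat \<Rightarrow> bool) \<Rightarrow> nat \<Rightarrow> nat \<Rightarrow> bool" where
  "pst_between n E a b \<longleftrightarrow>
     a < n \<and> b < n \<and> b \<noteq> a \<and>
     (\<exists>t>0. \<exists>\<beta>. cmod \<beta> = 1 \<and> transition_mat n E t *\<^sub>v unit_vec n a = \<beta> \<cdot>\<^sub>v unit_vec n b)"

definition admits_pst :: "nat \<Rightarrow> (nat \<Rightarrow> nat \<Rightarrow> bool) \<Rightarrow> bool" where
  "admits_pst n E \<longleftrightarrow> (\<exists>a b. pst_between n E a b)"

(* Residue classes mod n are represented by 0, ..., n - 1; the difference of two representatives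
   is taken in the integers, as subtraction on nat truncates. *)
definition quc_adj :: "nat \<Rightarrow> nat \<Rightarrow> nat \<Rightarrow> bool" where
  "quc_adj n a b \<longleftrightarrow> a \<noteq> b \<and>
     (\<exists>u::int. 1 \<le> u \<and> u \<le> int n - 1 \<and> coprime u (int n) \<and>
        ([int a - int b = u\<^sup>2] (mod int n) \<or> [int a - int b = - (u\<^sup>2)] (mod int n)))"

lemma quc_adj_irrefl: "\<not> quc_adj n a a"
  by (simp add: quc_adj_def)

lemma quc_adj_sym: "quc_adj n a b \<Longrightarrow> quc_adj n b a"
proof -
  have neg: "[int b - int a = - c] (mod int n)" if "[int a - int b = c] (mod int n)" for c
    using that cong_minus_minus_iff[of "int a - int b" c "int n"] by simp
  assume "quc_adj n a b"
  then show ?thesis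
    unfolding quc_adj_def using neg by force
qed

lemma mat_exp_summable:
  assumes A: "A \<in> carrier_mat n n" and ij: "i < n" "j < n"
  shows "summable (\<lambda>k. (A ^\<^sub>m k) $$ (i, j) / fact k :: complex)"
proof -
  obtain b where b: "norm_bound A b"
    using norm_bound_max[of A] by blast
  define c where "c = b * of_nat n"
  have bound: "norm_bound (A ^\<^sub>m k) (c ^ k)" for k
  proof (induction k)
    case 0
    then show ?case
      using A by (auto simp: norm_bound_def one_mat_def)
  next
    case (Suc k)
    have "norm_bound (A ^\<^sub>m k * A) (c ^ k * b * of_nat n)"
      by (rule norm_bound_mult[OF pow_carrier_mat[OF A] A Suc b])
    then show ?case
      by (simp add: c_def mult_ac)
  qed
  have "summable (\<lambda>k. c ^ k / fact k)"
    using summable_exp[of c] by (simp add: divide_inverse mult.commute)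
  moreover have "norm ((A ^\<^sub>m k) $$ (i, j) / fact k) \<le> c ^ k / fact k" for k
  proof -
    have "norm ((A ^\<^sub>m k) $$ (i, j)) \<le> c ^ k"
      using bound[of k] A ij pow_carrier_mat[OF A, of k] by (auto simp: norm_bound_def)
    then show ?thesis
      by (simp add: norm_divide divide_right_mono)
  qed
  ultimately show ?thesis
    by (rule summable_comparison_test'[where N = 0])
qed

end

theory Submission
  imports Defs
begin

text \<open>
  Let \<open>S\<close> be the connection set and \<open>\<lambda> m = (\<Sum>s\<in>S. cos (2 * pi * m * s / n))\<close> the eigenvalues.
  Transfer from \<open>a\<close> to \<open>b\<close> at time \<open>t\<close> means, in the character basis, that
  \<open>exp (- \<i> * t * \<lambda> m) = \<beta> * \<chi> (m * (b - a))\<close> for all \<open>m\<close>. As \<open>\<lambda> (- m) = \<lambda> m\<close>, this forces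
  \<open>\<chi> (b - a) = - 1\<close>, so \<open>n\<close> is even and the right-hand side is \<open>\<beta> * (- 1) ^ m\<close>. Hence every
  integral linear relation between eigenvalues yields an equation for \<open>\<beta>\<close>. The elements of \<open>S\<close> are
  units, so \<open>\<lambda> (n / 2) = - \<lambda> 0\<close> gives \<open>\<beta>\<^sup>2 = (- 1) ^ (n / 2)\<close>; for an odd divisor \<open>p > 1\<close>
  the vanishing of \<open>\<Sum>r<p. \<lambda> (r * n / p)\<close> gives \<open>\<beta> ^ p = 1\<close>; and \<open>\<lambda> (n / 4) = 0\<close> if
  \<open>4 dvd n\<close>. Together they leave only \<open>n = 2\<close>, \<open>n = 4\<close> and \<open>8 dvd n\<close>. In the last case \<open>S\<close>
  reduces to \<open>\<plusminus> 1\<close> modulo \<open>8\<close>, so \<open>\<lambda> (n / 8) = \<lambda> 0 / sqrt 2\<close>, whereas \<open>\<beta> ^ 4 = 1\<close>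
  makes \<open>t * \<lambda>\<close> a multiple of \<open>pi / 2\<close> for all eigenvalues, against the irrationality of \<open>sqrt 2\<close>.
\<close>

subsection \<open>Spectral description of perfect state transfer on circulant graphs\<close>

text \<open>Left eigenvectors are the useful ones here: pairing a character with column
  \<open>a\<close> of the transition matrix gives a Fourier coefficient of the state reached from
  \<open>a\<close>.\<close>

lemma left_eigenvector_pow_mat:
  fixes B :: "complex mat"
  assumes B: "B \<in> carrier_mat n n"
    and eig: "\<And>a. a < n \<Longrightarrow> (\<Sum>i<n. w i * B $$ (i, a)) = \<mu> * w a"
    and "a < n"
  shows "(\<Sum>i<n. w i * (B ^\<^sub>m k) $$ (i, a)) = \<mu> ^ k * w a"
  using \<open>a < n\<close>
proof (induction k arbitrary: a)
  case 0
  have "(\<Sum>i<n. w i * (B ^\<^sub>m 0) $$ (i, a)) = (\<Sum>i<n. if i = a then w i else 0)"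
    using B 0 by (intro sum.cong) auto
  then show ?case
    using 0 by simp
next
  case (Suc k)
  have Bk: "B ^\<^sub>m k \<in> carrier_mat n n"
    using B by (rule pow_carrier_mat)
  have "(\<Sum>i<n. w i * (B ^\<^sub>m Suc k) $$ (i, a))
      = (\<Sum>i<n. \<Sum>l<n. w i * (B ^\<^sub>m k) $$ (i, l) * B $$ (l, a))"
    using B Bk Suc.prems
    by (intro sum.cong) (auto simp: scalar_prod_def sum_distrib_left atLeast0LessThan mult.assoc)
  also have "\<dots> = (\<Sum>l<n. (\<Sum>i<n. w i * (B ^\<^sub>m k) $$ (i, l)) * B $$ (l, a))"
    by (subst sum.swap) (simp add: sum_distrib_right)
  also have "\<dots> = \<mu> ^ k * (\<Sum>l<n. w l * B $$ (l, a))"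
    by (simp add: Suc.IH sum_distrib_left mult.assoc)
  finally show ?case
    by (simp add: eig Suc.prems)
qed

text \<open>The finite sum over \<open>i\<close> commutes with the entrywise series; termwise this
  leaves the exponential series of \<open>\<mu>\<close>.\<close>

lemma left_eigenvector_mat_exp:
  assumes B: "B \<in> carrier_mat n n"
    and eig: "\<And>a. a < n \<Longrightarrow> (\<Sum>i<n. w i * B $$ (i, a)) = \<mu> * w a"
    and a: "a < n"
  shows "(\<Sum>i<n. w i * mat_exp B $$ (i, a)) = exp \<mu> * w a"
proof -
  have "(\<lambda>k. \<Sum>i<n. w i * ((B ^\<^sub>m k) $$ (i, a) / fact k)) sums (\<Sum>i<n. w i * mat_exp B $$ (i, a))"
  proof (intro sums_sum sums_mult)
    fix i assume "i \<in> {..<n}"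
    then show "(\<lambda>k. (B ^\<^sub>m k) $$ (i, a) / fact k) sums (mat_exp B $$ (i, a))"
      using B a summable_sums[OF mat_exp_summable[OF B, of i a]] by (simp add: mat_exp_def)
  qed
  moreover have "(\<Sum>i<n. w i * ((B ^\<^sub>m k) $$ (i, a) / fact k)) = \<mu> ^ k /\<^sub>R fact k * w a" for k
  proof -
    have "(\<Sum>i<n. w i * ((B ^\<^sub>m k) $$ (i, a) / fact k)) = \<mu> ^ k * w a / fact k"
      using left_eigenvector_pow_mat[OF B eig a, of k] by (simp flip: sum_divide_distrib)
    then show ?thesis
      by (simp add: scaleR_conv_of_real divide_inverse mult_ac)
  qed
  moreover have "(\<lambda>k. \<mu> ^ k /\<^sub>R fact k * w a) sums (exp \<mu> * w a)"
    by (intro sums_mult2 exp_converges)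
  ultimately show ?thesis
    using sums_unique2 by force
qed

section \<open>Characters of the cyclic group of order n and Fourier inversion\<close>

definition chi :: "nat \<Rightarrow> int \<Rightarrow> complex" where
  "chi n k = cis (2 * pi * of_int k / of_nat n)"

lemma chi_0 [simp]: "chi n 0 = 1"
  by (simp add: chi_def)

lemma chi_nonzero [simp]: "chi n k \<noteq> 0"
  by (simp add: chi_def)

lemma chi_add: "chi n (k + l) = chi n k * chi n l"
  by (simp add: chi_def cis_mult ring_distribs add_divide_distrib)

lemma chi_mult_nat: "chi n (int m * k) = chi n k ^ m"
  by (simp add: chi_def Complex.DeMoivre mult_ac)

lemma chi_eq_1_iff:
  assumes "n > 0"
  shows "chi n k = 1 \<longleftrightarrow> int n dvd k"
proof
  assume "chi n k = 1"
  then have "cos (2 * pi * of_int k / of_nat n) = 1"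
    by (metis chi_def cis.sel(1) one_complex.sel(1))
  then obtain m :: int where "2 * pi * of_int k / of_nat n = m * 2 * pi"
    by (auto simp: cos_one_2pi_int)
  then have "real_of_int k = of_int (m * int n)"
    using assms by (simp add: field_simps)
  then have "k = m * int n"
    by (simp only: of_int_eq_iff)
  then show "int n dvd k"
    by simp
next
  assume "int n dvd k"
  then obtain m where "k = int n * m" ..
  then have "2 * pi * of_int k / of_nat n = 2 * pi * of_int m"
    using assms by simp
  then show "chi n k = 1"
    unfolding chi_def by (metis cis_multiple_2pi Ints_of_int)
qed

lemma chi_cong:
  assumes "n > 0" "[k = l] (mod int n)"
  shows "chi n k = chi n l"
proof -
  have "chi n (k - l) = 1"
    using assms by (simp add: chi_eq_1_iff cong_iff_dvd_diff)
  then show ?thesis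
    using chi_add[of n "k - l" l] by simp
qed

text \<open>Orthogonality of characters: a geometric sum whose ratio \<open>chi n k\<close> is an
  n-th root of unity.\<close>

lemma sum_chi:
  assumes "n > 0"
  shows "(\<Sum>j<n. chi n (int j * k)) = (if int n dvd k then of_nat n else 0)"
proof (cases "int n dvd k")
  case True
  then have "chi n k = 1"
    using assms by (simp add: chi_eq_1_iff)
  then show ?thesis
    using True by (simp add: chi_mult_nat)
next
  case False
  then have "chi n k \<noteq> 1"
    using assms by (simp add: chi_eq_1_iff)
  moreover have "chi n k ^ n = 1"
    using assms by (simp add: chi_eq_1_iff flip: chi_mult_nat)
  ultimately show ?thesis
    using False by (simp add: chi_mult_nat geometric_sum)
qed

text \<open>The inverse transform, by orthogonality, recovers \<open>of_nat n * f l\<close> from the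
  Fourier coefficients of \<open>f\<close>.\<close>

lemma fourier_injective:
  assumes eq: "\<And>j. j < n \<Longrightarrow> (\<Sum>i<n. chi n (int j * int i) * g i) = (\<Sum>i<n. chi n (int j * int i) * h i)"
    and l: "l < n"
  shows "g l = h l"
proof -
  have *: "(\<Sum>j<n. chi n (- (int j * int l)) * (\<Sum>i<n. chi n (int j * int i) * f i)) = of_nat n * f l"
    for f :: "nat \<Rightarrow> complex"
  proof -
    have "(\<Sum>j<n. chi n (- (int j * int l)) * (\<Sum>i<n. chi n (int j * int i) * f i))
        = (\<Sum>i<n. (\<Sum>j<n. chi n (int j * (int i - int l))) * f i)"
      unfolding sum_distrib_left sum_distrib_right
      by (subst sum.swap, intro sum.cong refl)
        (simp add: algebra_simps flip: chi_add)
    also have "\<dots> = (\<Sum>i<n. if i = l then of_nat n * f i else 0)"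
    proof (rule sum.cong)
      fix i assume "i \<in> {..<n}"
      then have "int n dvd int i - int l \<longleftrightarrow> i = l"
        using l by (metis cong_iff_dvd_diff cong_int_iff cong_less_modulus_unique_nat lessThan_iff
            cong_refl)
      then show "(\<Sum>j<n. chi n (int j * (int i - int l))) * f i = (if i = l then of_nat n * f i else 0)"
        using l by (simp add: sum_chi)
    qed simp
    finally show ?thesis
      using l by simp
  qed
  have "of_nat n * g l = of_nat n * h l"
    unfolding *[symmetric] by (simp add: eq)
  then show ?thesis
    using l by simp
qed

section \<open>Circulant graphs are diagonalised by the characters\<close>

definition circ_eigenvalue :: "nat \<Rightarrow> nat set \<Rightarrow> int \<Rightarrow> complex" where
  "circ_eigenvalue n S j = (\<Sum>s\<in>S. chi n (j * int s))"

definition circulant :: "nat \<Rightarrow> (nat \<Rightarrow> nat \<Rightarrow> bool) \<Rightarrow> nat set \<Rightarrow> bool" where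
  "circulant n E S \<longleftrightarrow> S \<subseteq> {..<n} \<and>
     (\<forall>a<n. \<forall>b<n. E a b \<longleftrightarrow> nat ((int a - int b) mod int n) \<in> S)"

text \<open>Writing the neighbours of \<open>a\<close> as \<open>s + a\<close> with \<open>s\<close>
  in \<open>S\<close> makes the factor \<open>chi n (j * int a)\<close> split off.\<close>

lemma circulant_left_eigenvector:
  assumes circ: "circulant n E S" and a: "a < n"
  shows "(\<Sum>i<n. chi n (j * int i) * adj_mat n E $$ (i, a)) = circ_eigenvalue n S j * chi n (j * int a)"
proof -
  have "(\<Sum>i<n. chi n (j * int i) * adj_mat n E $$ (i, a))
      = (\<Sum>i\<in>{i. i < n \<and> E i a}. chi n (j * int i))"
    using a by (simp add: adj_mat_def if_distrib sum.inter_filter[symmetric] cong: if_cong)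
  also have "\<dots> = (\<Sum>s\<in>S. chi n (j * int s) * chi n (j * int a))"
  proof (rule sum.reindex_bij_witness[of _ "\<lambda>s. (s + a) mod n" "\<lambda>i. nat ((int i - int a) mod int n)"])
    fix i assume i: "i \<in> {i. i < n \<and> E i a}"
    then show "nat ((int i - int a) mod int n) \<in> S"
      using circ a unfolding circulant_def by blast
    have *: "int (nat ((int i - int a) mod int n)) = (int i - int a) mod int n"
      using a by simp
    have "int ((nat ((int i - int a) mod int n) + a) mod n) = int i"
      using i by (simp add: zmod_int * mod_add_left_eq)
    then show "(nat ((int i - int a) mod int n) + a) mod n = i"
      by simp
    have "[j * ((int i - int a) mod int n) + j * int a = j * int i] (mod int n)"
      unfolding ring_distribs[symmetric] by (intro cong_mult) (simp_all add: cong_def mod_add_left_eq)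
    then show "chi n (j * int (nat ((int i - int a) mod int n))) * chi n (j * int a) = chi n (j * int i)"
      unfolding * chi_add[symmetric] using a by (intro chi_cong) auto
  next
    fix s assume s: "s \<in> S"
    then have "s < n"
      using circ by (auto simp: circulant_def)
    have "(int ((s + a) mod n) - int a) mod int n = int s"
      using \<open>s < n\<close> by (simp add: zmod_int mod_diff_left_eq)
    then show "nat ((int ((s + a) mod n) - int a) mod int n) = s"
      by simp
    then show "(s + a) mod n \<in> {i. i < n \<and> E i a}"
      using circ a s by (simp add: circulant_def)
  qed
  finally show ?thesis
    by (simp add: circ_eigenvalue_def sum_distrib_right)
qed

lemma circulant_transition_fourier:
  assumes circ: "circulant n E S" and a: "a < n"
  shows "(\<Sum>i<n. chi n (j * int i) * transition_mat n E t $$ (i, a))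
    = exp (- \<i> * of_real t * circ_eigenvalue n S j) * chi n (j * int a)"
  unfolding transition_mat_def
proof (rule left_eigenvector_mat_exp)
  show "(- \<i> * complex_of_real t) \<cdot>\<^sub>m adj_mat n E \<in> carrier_mat n n"
    by (simp add: adj_mat_def)
  show "(\<Sum>i<n. chi n (j * int i) * ((- \<i> * complex_of_real t) \<cdot>\<^sub>m adj_mat n E) $$ (i, a))
      = - \<i> * of_real t * circ_eigenvalue n S j * chi n (j * int a)" if a: "a < n" for a
  proof -
    have "(\<Sum>i<n. chi n (j * int i) * ((- \<i> * complex_of_real t) \<cdot>\<^sub>m adj_mat n E) $$ (i, a))
        = - \<i> * of_real t * (\<Sum>i<n. chi n (j * int i) * adj_mat n E $$ (i, a))"
      unfolding sum_distrib_left using a by (intro sum.cong) (auto simp: adj_mat_def)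
    then show ?thesis
      by (simp add: circulant_left_eigenvector[OF circ a])
  qed
qed (rule a)

lemma transition_mat_carrier: "transition_mat n E t \<in> carrier_mat n n"
  by (simp add: transition_mat_def mat_exp_def adj_mat_def)

lemma transition_mat_unit_vec_iff:
  assumes "a < n" "b < n"
  shows "transition_mat n E t *\<^sub>v unit_vec n a = \<beta> \<cdot>\<^sub>v unit_vec n b \<longleftrightarrow>
    (\<forall>i<n. transition_mat n E t $$ (i, a) = (if i = b then \<beta> else 0))"
  using assms transition_mat_carrier[of n E t] by (auto simp: vec_eq_iff)

text \<open>Column \<open>a\<close> of the transition matrix equals \<open>\<beta>\<close> times the
  unit vector at \<open>b\<close> iff their Fourier transforms agree; the backward direction is
  \<open>fourier_injective\<close>.\<close>

lemma pst_between_circulant_iff: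
  assumes circ: "circulant n E S"
  shows "pst_between n E a b \<longleftrightarrow> a < n \<and> b < n \<and> b \<noteq> a \<and>
    (\<exists>t>0. \<exists>\<beta>. cmod \<beta> = 1 \<and> (\<forall>j. exp (- \<i> * of_real t * circ_eigenvalue n S j)
       * chi n (j * int a) = \<beta> * chi n (j * int b)))"
proof -
  have "transition_mat n E t *\<^sub>v unit_vec n a = \<beta> \<cdot>\<^sub>v unit_vec n b \<longleftrightarrow>
      (\<forall>j. exp (- \<i> * of_real t * circ_eigenvalue n S j) * chi n (j * int a)
         = \<beta> * chi n (j * int b))" (is "?L \<longleftrightarrow> ?R")
    if ab: "a < n" "b < n" for t \<beta>
  proof -
    have \<delta>: "(\<Sum>i<n. chi n (j * int i) * (if i = b then \<beta> else 0)) = \<beta> * chi n (j * int b)" for j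
      using ab by (simp add: if_distrib cong: if_cong)
    show ?thesis
      unfolding transition_mat_unit_vec_iff[OF ab]
        circulant_transition_fourier[OF circ ab(1), symmetric] \<delta>[symmetric]
      using fourier_injective[of n "\<lambda>i. transition_mat n E t $$ (i, a)"
          "\<lambda>i. if i = b then \<beta> else 0"]
      by (intro iffI allI sum.cong) auto
  qed
  then show ?thesis
    unfolding pst_between_def by blast
qed

subsection \<open>The quadratic unitary Cayley graph\<close>

text \<open>With \<open>u\<close> ranging over all integers coprime to \<open>n\<close>, this is
  visibly a property of the residue class of \<open>x\<close> and invariant under negation.\<close>

definition pm_unit_square :: "nat \<Rightarrow> int \<Rightarrow> bool" where
  "pm_unit_square n x \<longleftrightarrow> (\<exists>u. coprime u (int n) \<and> ([x = u\<^sup>2] (mod int n) \<or> [x = - (u\<^sup>2)] (mod int n)))"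

definition conn_set :: "nat \<Rightarrow> nat set" where
  "conn_set n = {s. s < n \<and> pm_unit_square n (int s)}"

lemma pm_unit_square_cong:
  assumes "[x = y] (mod int n)"
  shows "pm_unit_square n x \<longleftrightarrow> pm_unit_square n y"
  unfolding pm_unit_square_def using assms by (meson cong_sym cong_trans)

lemma pm_unit_square_uminus: "pm_unit_square n (- x) \<longleftrightarrow> pm_unit_square n x"
proof -
  have "[- x = - c] (mod int n) \<longleftrightarrow> [x = c] (mod int n)" for c
    by (rule cong_minus_minus_iff)
  from this[of "u\<^sup>2" for u] this[of "- (u\<^sup>2)" for u] show ?thesis
    unfolding pm_unit_square_def by auto
qed

lemma pm_unit_square_imp_coprime:
  assumes "pm_unit_square n x"
  shows "coprime x (int n)"
proof -
  obtain u where u: "coprime u (int n)" "[x = u\<^sup>2] (mod int n) \<or> [x = - (u\<^sup>2)] (mod int n)"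
    using assms by (auto simp: pm_unit_square_def)
  have "coprime (u\<^sup>2) (int n)" "coprime (- (u\<^sup>2)) (int n)"
    using u(1) by simp_all
  then show ?thesis
    using u(2) cong_imp_coprime cong_sym by blast
qed

text \<open>A witness can be reduced modulo \<open>n\<close> into the required range. For
  \<open>n \<ge> 2\<close> coprimality to \<open>n\<close> excludes residue 0, both for the witness
  and for the difference of the vertices.\<close>

lemma quc_adj_iff:
  assumes n: "n \<ge> 2"
  shows "quc_adj n a b \<longleftrightarrow> pm_unit_square n (int a - int b)"
proof
  assume "quc_adj n a b"
  then show "pm_unit_square n (int a - int b)"
    unfolding quc_adj_def pm_unit_square_def by blast
next
  assume P: "pm_unit_square n (int a - int b)"
  then obtain u where u: "coprime u (int n)"
      "[int a - int b = u\<^sup>2] (mod int n) \<or> [int a - int b = - (u\<^sup>2)] (mod int n)"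
    by (auto simp: pm_unit_square_def)
  define v where "v = u mod int n"
  have uv: "[u = v] (mod int n)"
    by (simp add: v_def cong_def)
  have cop: "coprime v (int n)"
    using cong_imp_coprime[OF uv u(1)] .
  have "[u\<^sup>2 = v\<^sup>2] (mod int n)" "[- (u\<^sup>2) = - (v\<^sup>2)] (mod int n)"
    using cong_pow[OF uv, of 2] by (simp_all add: cong_minus_minus_iff)
  then have sq: "[int a - int b = v\<^sup>2] (mod int n) \<or> [int a - int b = - (v\<^sup>2)] (mod int n)"
    using u(2) cong_trans by blast
  have "v \<noteq> 0"
    using cop n by auto
  moreover have "0 \<le> v" "v < int n"
    using n by (simp_all add: v_def)
  moreover have "a \<noteq> b"
    using pm_unit_square_imp_coprime[OF P] n by auto
  ultimately show "quc_adj n a b"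
    unfolding quc_adj_def using cop sq by (intro conjI exI[of _ v]) auto
qed

lemma circulant_quc:
  assumes n: "n \<ge> 2"
  shows "circulant n (quc_adj n) (conn_set n)"
  unfolding circulant_def
proof (intro conjI allI impI)
  fix a b assume "a < n" "b < n"
  have "pm_unit_square n ((int a - int b) mod int n) \<longleftrightarrow> pm_unit_square n (int a - int b)"
    by (rule pm_unit_square_cong) (simp add: cong_def)
  then show "quc_adj n a b \<longleftrightarrow> nat ((int a - int b) mod int n) \<in> conn_set n"
    using n by (simp add: quc_adj_iff conn_set_def nat_less_iff)
qed (auto simp: conn_set_def)

lemma finite_conn_set [simp]: "finite (conn_set n)"
  by (simp add: conn_set_def)

lemma conn_set_coprime: "s \<in> conn_set n \<Longrightarrow> coprime s n"
  using pm_unit_square_imp_coprime[of n "int s"] by (simp add: conn_set_def)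

lemma card_conn_set_pos:
  assumes "n \<ge> 2"
  shows "card (conn_set n) > 0"
proof -
  have "1 \<in> conn_set n"
    using assms by (auto simp: conn_set_def pm_unit_square_def intro!: exI[of _ 1])
  then show ?thesis
    by (metis card_gt_0_iff empty_iff finite_conn_set)
qed

abbreviation quc_eigenvalue :: "nat \<Rightarrow> int \<Rightarrow> complex" where
  "quc_eigenvalue n \<equiv> circ_eigenvalue n (conn_set n)"

text \<open>The connection set is closed under negation modulo \<open>n\<close>, so \<open>s\<close>
  may be replaced by \<open>n - s\<close>.\<close>

lemma quc_eigenvalue_uminus:
  assumes n: "n \<ge> 2"
  shows "quc_eigenvalue n (- j) = quc_eigenvalue n j"
  unfolding circ_eigenvalue_def
proof (rule sum.reindex_bij_witness[of _ "\<lambda>s. n - s" "\<lambda>s. n - s"])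
  have neg: "n - s \<in> conn_set n" "s \<le> n" if s: "s \<in> conn_set n" for s
  proof -
    have "s < n" "pm_unit_square n (int s)"
      using s by (auto simp: conn_set_def)
    \<comment> \<open>Without this \<open>n - s\<close> could equal \<open>n\<close>, which is not a
      representative below \<open>n\<close>.\<close>
    moreover have "s \<noteq> 0"
      using conn_set_coprime[OF s] n by (intro notI) auto
    moreover have "pm_unit_square n (int n - int s) \<longleftrightarrow> pm_unit_square n (- int s)"
      by (rule pm_unit_square_cong) (simp add: cong_def)
    ultimately show "n - s \<in> conn_set n" "s \<le> n"
      by (simp_all add: conn_set_def pm_unit_square_uminus of_nat_diff)
  qed
  fix s assume s: "s \<in> conn_set n"
  then show "n - (n - s) = s" "n - s \<in> conn_set n" "n - (n - s) = s" "n - s \<in> conn_set n"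
    using neg by simp_all
  show "chi n (j * int (n - s)) = chi n (- j * int s)"
    using n neg[OF s] by (intro chi_cong) (simp_all add: of_nat_diff cong_iff_dvd_diff algebra_simps)
qed

section \<open>Real form of the eigenvalues and their values at special indices\<close>

definition quc_spectrum :: "nat \<Rightarrow> nat \<Rightarrow> real" where
  "quc_spectrum n m = (\<Sum>s\<in>conn_set n. cos (2 * pi * real m * real s / real n))"

text \<open>Adding the equal eigenvalues at \<open>m\<close> and \<open>- m\<close> cancels the
  sines.\<close>

lemma quc_eigenvalue_eq_spectrum:
  assumes n: "n \<ge> 2"
  shows "quc_eigenvalue n (int m) = of_real (quc_spectrum n m)"
proof -
  have "2 * quc_eigenvalue n (int m) = quc_eigenvalue n (int m) + quc_eigenvalue n (- int m)"
    by (simp add: quc_eigenvalue_uminus[OF n])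
  also have "\<dots> = 2 * of_real (quc_spectrum n m)"
    unfolding circ_eigenvalue_def quc_spectrum_def sum.distrib[symmetric] of_real_sum sum_distrib_left
    by (intro sum.cong) (auto simp: chi_def complex_eq_iff mult_ac)
  finally show ?thesis
    by simp
qed

lemma conn_set_odd: "s \<in> conn_set n \<Longrightarrow> even n \<Longrightarrow> odd s"
  using conn_set_coprime coprime_common_divisor_nat[of s n 2] by auto

text \<open>Units modulo \<open>n\<close> are odd here, and odd squares are 1 modulo 8; the residue
  7 comes from the negated squares.\<close>

lemma conn_set_mod_8:
  assumes s: "s \<in> conn_set n" and "8 dvd n"
  shows "s mod 8 = 1 \<or> s mod 8 = 7"
proof -
  obtain u where u: "coprime u (int n)" "[int s = u\<^sup>2] (mod int n) \<or> [int s = - (u\<^sup>2)] (mod int n)"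
    using s by (auto simp: conn_set_def pm_unit_square_def)
  have "8 dvd int n"
    using \<open>8 dvd n\<close> by presburger
  then have "[int s = u\<^sup>2] (mod 8) \<or> [int s = - (u\<^sup>2)] (mod 8)"
    using u(2) cong_dvd_modulus by blast
  then have *: "int s mod 8 = u\<^sup>2 mod 8 \<or> int s mod 8 = (- (u\<^sup>2)) mod 8"
    by (simp only: cong_def)
  have "odd u"
  proof
    assume "even u"
    moreover have "even (int n)"
      using \<open>8 dvd int n\<close> by presburger
    ultimately show False
      using u(1) coprime_common_divisor[of u "int n" 2] by simp
  qed
  then obtain k where k: "u = 2 * k + 1" ..
  have "even (k * (k + 1))"
    by simp
  then obtain l where "k * (k + 1) = 2 * l" ..
  then have "u\<^sup>2 = 8 * l + 1"
    unfolding k by (simp add: power2_eq_square algebra_simps)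
  with * have "int s mod 8 = (8 * l + 1) mod 8 \<or> int s mod 8 = (- (8 * l + 1)) mod 8"
    by (simp only:)
  moreover have "(8 * l + 1) mod 8 = 1" "(- (8 * l + 1)) mod 8 = 7"
    by presburger+
  ultimately have "int (s mod 8) = 1 \<or> int (s mod 8) = 7"
    by (simp only: zmod_int of_nat_numeral)
  then show ?thesis
    by linarith
qed

lemma cos_pi_quarter_multiple:
  assumes "s mod 8 = 1 \<or> s mod 8 = 7"
  shows "cos (pi * real s / 4) = sqrt 2 / 2"
proof -
  \<comment> \<open>The second case says that \<open>s\<close> is one less than a multiple of 8,
    phrased without truncated subtraction. Both cases put the angle at plus or minus
    \<open>pi / 4\<close> up to full turns.\<close>
  have "s = 8 * (s div 8) + 1 \<or> s + 1 = 8 * (s div 8 + 1)"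
    using assms by presburger
  then obtain k :: nat where "s = 8 * k + 1 \<or> s + 1 = 8 * k"
    by blast
  then have "real s = 8 * real k + 1 \<or> real s = 8 * real k - 1"
    by linarith
  moreover have "pi * (8 * real k + 1) / 4 = 2 * pi * real k + pi / 4"
      "pi * (8 * real k - 1) / 4 = 2 * pi * real k - pi / 4"
    by (simp_all add: field_simps)
  ultimately have *: "pi * real s / 4 = 2 * pi * real k + pi / 4 \<or>
      pi * real s / 4 = 2 * pi * real k - pi / 4"
    by (elim disjE) (simp_all only: simp_thms)
  have "cos (2 * pi * real k) = 1" "sin (2 * pi * real k) = 0"
    using cos_2npi[of k] sin_2npi[of k] by (simp_all only: mult_ac)
  then have "cos (2 * pi * real k + pi / 4) = sqrt 2 / 2" "cos (2 * pi * real k - pi / 4) = sqrt 2 / 2"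
    by (simp_all add: cos_add cos_diff cos_45)
  with * show ?thesis
    by (elim disjE) (simp_all only:)
qed

lemma quc_spectrum_0: "quc_spectrum n 0 = card (conn_set n)"
  by (simp add: quc_spectrum_def)

lemma quc_spectrum_half:
  assumes "n > 0" "even n"
  shows "quc_spectrum n (n div 2) = - real (card (conn_set n))"
proof -
  have "quc_spectrum n (n div 2) = (\<Sum>s\<in>conn_set n. - 1)"
    unfolding quc_spectrum_def
  proof (rule sum.cong)
    fix s assume "s \<in> conn_set n"
    then have "odd s"
      using assms by (simp add: conn_set_odd)
    moreover have "2 * pi * real (n div 2) * real s / real n = pi * real s"
      using assms by (simp add: real_of_nat_div)
    ultimately show "cos (2 * pi * real (n div 2) * real s / real n) = - 1"
      by simp
  qed simp
  then show ?thesis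
    by simp
qed

lemma quc_spectrum_quarter:
  assumes "n > 0" "4 dvd n"
  shows "quc_spectrum n (n div 4) = 0"
  unfolding quc_spectrum_def
proof (rule sum.neutral, rule ballI)
  fix s assume "s \<in> conn_set n"
  then have "odd s"
    using assms by (intro conn_set_odd) auto
  moreover have "2 * pi * real (n div 4) * real s / real n = real s * (pi / 2)"
    using assms by (simp add: real_of_nat_div)
  ultimately show "cos (2 * pi * real (n div 4) * real s / real n) = 0"
    by (auto simp: cos_zero_iff)
qed

text \<open>Supplies the irrational ratio to \<open>quc_spectrum n 0\<close> that finally excludes
  \<open>8 dvd n\<close>.\<close>

lemma quc_spectrum_eighth:
  assumes "n > 0" "8 dvd n"
  shows "quc_spectrum n (n div 8) = card (conn_set n) * (sqrt 2 / 2)"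
proof -
  have "quc_spectrum n (n div 8) = (\<Sum>s\<in>conn_set n. sqrt 2 / 2)"
    unfolding quc_spectrum_def
  proof (rule sum.cong)
    fix s assume "s \<in> conn_set n"
    then have "cos (pi * real s / 4) = sqrt 2 / 2"
      using assms by (intro cos_pi_quarter_multiple conn_set_mod_8)
    moreover have "2 * pi * real (n div 8) * real s / real n = pi * real s / 4"
      using assms by (simp add: real_of_nat_div)
    ultimately show "cos (2 * pi * real (n div 8) * real s / real n) = sqrt 2 / 2"
      by (simp only:)
  qed simp
  then show ?thesis
    by simp
qed

text \<open>After exchanging the sums, each \<open>s\<close> contributes a full geometric sum of a
  p-th root of unity, which differs from 1 because \<open>s\<close> is coprime to
  \<open>p\<close>.\<close>

lemma sum_quc_spectrum_multiples:
  assumes n: "n \<ge> 2" and p: "p dvd n" "p > 1"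
  shows "(\<Sum>r<p. quc_spectrum n (r * (n div p))) = 0"
proof -
  have "complex_of_real (\<Sum>r<p. quc_spectrum n (r * (n div p)))
      = (\<Sum>s\<in>conn_set n. \<Sum>r<p. chi n (int r * (int (n div p) * int s)))"
    by (subst sum.swap)
      (simp add: quc_eigenvalue_eq_spectrum[OF n, symmetric] circ_eigenvalue_def mult.assoc)
  also have "\<dots> = 0"
  proof (rule sum.neutral, rule ballI)
    fix s assume s: "s \<in> conn_set n"
    let ?z = "chi n (int (n div p) * int s)"
    have np: "n = p * (n div p)" "n div p > 0"
      using p n by (simp_all add: div_greater_zero_iff dvd_imp_le)
    have "\<not> n dvd n div p * s"
    proof
      assume "n dvd n div p * s"
      then have "p * (n div p) dvd s * (n div p)"
        using np(1) by (simp add: mult.commute)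
      then have "p dvd s"
        using np(2) by simp
      then show False
        using conn_set_coprime[OF s] p coprime_common_divisor_nat[of s n p] by simp
    qed
    then have "?z \<noteq> 1"
      using n by (simp add: chi_eq_1_iff flip: of_nat_mult)
    moreover have "?z ^ p = chi n (int (n * s))"
      using np(1) by (simp flip: chi_mult_nat of_nat_mult mult.assoc)
    then have "?z ^ p = 1"
      using n by (simp add: chi_eq_1_iff)
    ultimately show "(\<Sum>r<p. chi n (int r * (int (n div p) * int s))) = 0"
      by (simp add: chi_mult_nat[of n _ "int (n div p) * int s"] geometric_sum)
  qed
  finally show ?thesis
    by (simp only: of_real_eq_0_iff)
qed

section \<open>Necessity: constraints on the phase of a transfer\<close>

lemma quc_pst_phases:
  assumes n: "n \<ge> 2" and pst: "pst_between n (quc_adj n) a b"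
  obtains t \<beta> where "t > 0" "even n" "\<And>m. cis (- (t * quc_spectrum n m)) = \<beta> * (- 1) ^ m"
proof -
  obtain t \<beta> where ab: "a < n" "b < n" "b \<noteq> a" and t: "t > 0" and "cmod \<beta> = 1"
    and E: "\<And>j. exp (- \<i> * of_real t * quc_eigenvalue n j) * chi n (j * int a) = \<beta> * chi n (j * int b)"
    using pst unfolding pst_between_circulant_iff[OF circulant_quc[OF n]] by blast
  define c where "c = int b - int a"
  define X where "X = exp (- \<i> * of_real t * quc_eigenvalue n 1)"
  have "\<beta> \<noteq> 0"
    using \<open>cmod \<beta> = 1\<close> by auto
  have shift: "chi n (j * int b) = chi n (j * int a) * chi n (j * c)" for j
    by (simp add: c_def algebra_simps flip: chi_add)
  have E': "exp (- \<i> * of_real t * quc_eigenvalue n j) = \<beta> * chi n (j * c)" for j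
    using E[of j] unfolding shift[of j] by simp
  \<comment> \<open>The indices 1 and -1 share an eigenvalue, so \<open>chi n c\<close> is its own
    inverse; it is not 1 since \<open>a\<close> and \<open>b\<close> are distinct.\<close>
  have "\<beta> * chi n (1 * c) = \<beta> * chi n (- 1 * c)"
    unfolding E'[symmetric] by (simp only: quc_eigenvalue_uminus[OF n])
  then have "chi n c = chi n (- c)"
    using \<open>\<beta> \<noteq> 0\<close> by simp
  then have "chi n c * chi n c = 1"
    using chi_add[of n c "- c"] by simp
  moreover have "chi n c \<noteq> 1"
  proof
    assume "chi n c = 1"
    then have "[int b = int a] (mod int n)"
      using n by (simp add: chi_eq_1_iff c_def cong_iff_dvd_diff)
    then show False
      using ab by (simp add: cong_def zmod_int)
  qed
  ultimately have c: "chi n c = - 1"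
    by (simp add: square_eq_1_iff)
  \<comment> \<open>\<open>chi n c\<close> is an n-th root of unity, and -1 is one only for even
    \<open>n\<close>.\<close>
  have "(- 1 :: complex) ^ n = 1"
    unfolding c[symmetric] using n by (simp add: chi_eq_1_iff flip: chi_mult_nat)
  then have "even n"
    by (cases "even n") auto
  moreover have "cis (- (t * quc_spectrum n m)) = \<beta> * (- 1) ^ m" for m
    using E'[of "int m"]
    by (simp add: chi_mult_nat c quc_eigenvalue_eq_spectrum[OF n] cis_conv_exp mult.assoc)
  ultimately show ?thesis
    using t that by blast
qed

lemma cis_eq_1_iff: "cis x = 1 \<longleftrightarrow> (\<exists>k::int. x = of_int k * 2 * pi)"
proof
  assume "cis x = 1"
  then have "cos x = 1"
    by (simp add: complex_eq_iff)
  then show "\<exists>k::int. x = of_int k * 2 * pi"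
    by (simp add: cos_one_2pi_int)
next
  assume "\<exists>k::int. x = of_int k * 2 * pi"
  then obtain k :: int where "x = 2 * pi * of_int k"
    by auto
  then show "cis x = 1"
    by (simp add: cis_multiple_2pi)
qed

text \<open>Irrationality of \<open>sqrt 2\<close> in integer form: for nonzero \<open>k\<close> the
  exponent of 2 would be even on the left and odd on the right.\<close>

lemma int_square_eq_double_square:
  fixes k l :: int
  assumes "k\<^sup>2 = 2 * l\<^sup>2"
  shows "k = 0"
proof (rule ccontr)
  assume "k \<noteq> 0"
  then have "l \<noteq> 0"
    using assms by auto
  have "multiplicity 2 (k\<^sup>2) = 2 * multiplicity 2 k" "multiplicity 2 (l\<^sup>2) = 2 * multiplicity 2 l"
    using \<open>k \<noteq> 0\<close> \<open>l \<noteq> 0\<close> by (simp_all add: prime_elem_multiplicity_power_distrib)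
  moreover have "multiplicity 2 (2 * l\<^sup>2) = Suc (multiplicity 2 (l\<^sup>2))"
    using \<open>l \<noteq> 0\<close> by (intro multiplicity_times_same) auto
  ultimately have "2 * multiplicity 2 k = Suc (2 * multiplicity 2 l)"
    by (simp only: assms)
  then show False
    by presburger
qed

lemma cis_sum: "cis (\<Sum>x\<in>A. f x) = (\<Prod>x\<in>A. cis (f x))"
  by (induction A rule: infinite_finite_induct) (simp_all add: cis_mult[symmetric])

text \<open>An odd divisor above 1 forces \<open>\<beta> = 1\<close>, and the indices
  \<open>n div 2\<close> and \<open>n div 4\<close> then give the factors of 2. Without such a
  divisor \<open>n\<close> is a power of 2, and the excluded values leave exponent at least
  3.\<close>

lemma quc_phases_imp_8_dvd:
  assumes n: "n \<ge> 2" "even n" "n \<noteq> 2" "n \<noteq> 4"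
    and ph: "\<And>m. cis (- (t * quc_spectrum n m)) = \<beta> * (- 1) ^ m"
    and sq: "\<beta>\<^sup>2 = (- 1) ^ (n div 2)"
  shows "8 dvd n"
proof (cases "\<exists>p. odd p \<and> p > 1 \<and> p dvd n")
  case True
  then obtain p where p: "odd p" "p > 1" "p dvd n"
    by blast
  \<comment> \<open>Makes every sign \<open>(- 1) ^ (r * (n div p))\<close> equal to 1, so the
    product of the phases below is \<open>\<beta> ^ p\<close>.\<close>
  have "even (n div p)"
    using n(2) p by (metis dvd_mult_div_cancel even_mult_iff)
  have "1 = cis (\<Sum>r<p. - (t * quc_spectrum n (r * (n div p))))"
    by (simp add: sum_negf sum_quc_spectrum_multiples[OF n(1) p(3,2)] flip: sum_distrib_left)
  also have "\<dots> = (\<Prod>r<p. cis (- (t * quc_spectrum n (r * (n div p)))))"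
    by (rule cis_sum)
  also have "\<dots> = \<beta> ^ p"
    using \<open>even (n div p)\<close> by (simp add: ph)
  finally have "\<beta> ^ p = 1" ..
  obtain q where q: "p = 2 * q + 1"
    using p(1) ..
  \<comment> \<open>By \<open>sq\<close> the second factor is a sign, hence so is
    \<open>\<beta>\<close>; the odd exponent \<open>p\<close> then rules out -1.\<close>
  have "\<beta> * (\<beta>\<^sup>2) ^ q = 1"
    using \<open>\<beta> ^ p = 1\<close> by (simp add: q power_mult)
  then have "\<beta> = 1 \<or> \<beta> = - 1"
    unfolding sq power_mult[symmetric] by (auto simp: minus_one_power_iff minus_equation_iff split: if_splits)
  with \<open>\<beta> ^ p = 1\<close> p(1) have "\<beta> = 1"
    by auto
  then have "even (n div 2)"
    using sq by (auto simp: minus_one_power_iff split: if_splits)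
  then have "4 dvd n"
    using n(2) by presburger
  \<comment> \<open>The eigenvalue at \<open>n div 4\<close> vanishes, so the phase there is
    1.\<close>
  then have "(- 1 :: complex) ^ (n div 4) = 1"
    using ph[of "n div 4"] n \<open>\<beta> = 1\<close> by (simp add: quc_spectrum_quarter)
  then have "even (n div 4)"
    by (auto simp: minus_one_power_iff split: if_splits)
  then show ?thesis
    using \<open>4 dvd n\<close> by presburger
next
  case False
  have "n \<noteq> 0"
    using n by simp
  then obtain m where mk: "n = 2 ^ multiplicity 2 n * m" "odd m"
    using multiplicity_decompose'[of n 2] by auto
  define k where "k = multiplicity 2 n"
  note mk = mk[folded k_def]
  have "\<not> m > 1"
    using False mk by (metis dvd_triv_right)
  then have "m = 1"
    using mk(2) by (cases m) auto
  then have "k \<noteq> 0" "k \<noteq> 1" "k \<noteq> 2"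
    using n mk by auto
  then have "3 \<le> k"
    by simp
  then have "2 ^ 3 dvd n"
    unfolding mk(1) using le_imp_power_dvd dvd_mult2 by blast
  then show ?thesis
    by simp
qed

lemma quc_pst_imp_2_or_4:
  assumes n: "n \<ge> 2" and pst: "pst_between n (quc_adj n) a b"
  shows "n = 2 \<or> n = 4"
proof (rule ccontr)
  assume neg: "\<not> (n = 2 \<or> n = 4)"
  obtain t \<beta> where t: "t > 0" and ev: "even n"
    and ph: "\<And>m. cis (- (t * quc_spectrum n m)) = \<beta> * (- 1) ^ m"
    using quc_pst_phases[OF n pst] by blast
  define d where "d = real (card (conn_set n))"
  have d: "d > 0"
    using card_conn_set_pos[OF n] by (simp add: d_def)
  \<comment> \<open>The eigenvalues at 0 and \<open>n div 2\<close> are \<open>d\<close> and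
    \<open>- d\<close>, so their phases are inverse to each other; multiplying them determines
    \<open>\<beta>\<^sup>2\<close>.\<close>
  have "cis (t * d) = \<beta> * (- 1) ^ (n div 2)"
    using ph[of "n div 2"] n ev by (simp add: quc_spectrum_half d_def)
  moreover have "cis (- (t * d)) = \<beta>"
    using ph[of 0] by (simp add: quc_spectrum_0 d_def)
  ultimately have "\<beta>\<^sup>2 * (- 1) ^ (n div 2) = cis (t * d) * cis (- (t * d))"
    by (simp add: power2_eq_square mult_ac)
  then have "\<beta>\<^sup>2 * (- 1) ^ (n div 2) = 1"
    by (simp add: cis_mult)
  then have sq: "\<beta>\<^sup>2 = (- 1) ^ (n div 2)"
    by (auto simp: minus_one_power_iff minus_equation_iff split: if_splits)
  have "8 dvd n"
    using quc_phases_imp_8_dvd[OF n ev _ _ ph sq] neg by blast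
  have "\<beta> ^ 4 = 1"
  proof -
    have "\<beta> ^ 4 = (\<beta>\<^sup>2)\<^sup>2"
      by simp
    then show ?thesis
      unfolding sq by (simp only: minus_one_power_iff) simp
  qed
  \<comment> \<open>The fourth power removes both \<open>\<beta>\<close> and the sign, so four times
    each phase angle is a multiple of \<open>2 * pi\<close>.\<close>
  have int: "\<exists>k::int. 4 * (t * quc_spectrum n m) = of_int k * 2 * pi" for m
  proof -
    have "cis (- (4 * (t * quc_spectrum n m))) = cis (- (t * quc_spectrum n m)) ^ 4"
      by (simp add: Complex.DeMoivre)
    also have "\<dots> = 1"
      unfolding ph by (simp add: power_mult_distrib \<open>\<beta> ^ 4 = 1\<close> minus_one_power_iff)
    finally obtain k :: int where "- (4 * (t * quc_spectrum n m)) = of_int k * 2 * pi"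
      unfolding cis_eq_1_iff by blast
    then show ?thesis
      by (intro exI[of _ "- k"]) simp
  qed
  obtain k where k: "4 * (t * d) = of_int k * 2 * pi"
    using int[of 0] by (auto simp: quc_spectrum_0 d_def)
  obtain l where l: "4 * (t * (d * (sqrt 2 / 2))) = of_int l * 2 * pi"
    using int[of "n div 8"] n \<open>8 dvd n\<close> by (auto simp: quc_spectrum_eighth d_def)
  \<comment> \<open>Indices 0 and \<open>n div 8\<close> involve the same \<open>t * d\<close>, so
    \<open>k\<close> and \<open>l\<close> inherit the ratio \<open>sqrt 2\<close>. This forces
    \<open>k = 0\<close>, against \<open>t * d > 0\<close>.\<close>
  have "of_int k * 2 * pi * (sqrt 2 / 2) = of_int l * 2 * pi"
    unfolding k[symmetric] l[symmetric] by simp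
  then have "of_int k * sqrt 2 = 2 * of_int l"
    by simp
  then have "(of_int k * sqrt 2)\<^sup>2 = (2 * of_int l)\<^sup>2"
    by simp
  then have "real_of_int (k\<^sup>2) = of_int (2 * l\<^sup>2)"
    by (simp add: power_mult_distrib)
  then have "k\<^sup>2 = 2 * l\<^sup>2"
    by (simp only: of_int_eq_iff)
  then have "k = 0"
    by (rule int_square_eq_double_square)
  then show False
    using k t d by simp
qed

section \<open>Sufficiency: the single edge and the 4-cycle, both at time
  \<open>pi / 2\<close>\<close>

lemma pst_2: "pst_between 2 (quc_adj 2) 0 1"
proof -
  have "s = 1" if "s \<in> conn_set 2" for s
    using conn_set_odd[OF that] that by (auto simp: conn_set_def less_2_cases_iff)
  moreover have "1 \<in> conn_set 2"
    by (auto simp: conn_set_def pm_unit_square_def intro!: exI[of _ 1])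
  ultimately have S: "conn_set 2 = {1}"
    by blast
  \<comment> \<open>The eigenvalue is \<open>chi 2 j\<close>, a sign, and the exponential sends a
    sign \<open>x\<close> to \<open>- \<i> * x\<close>; hence the phase
    \<open>- \<i>\<close>.\<close>
  have "exp (- \<i> * of_real (pi / 2) * quc_eigenvalue 2 j) = - \<i> * chi 2 j" for j
  proof -
    have "chi 2 j * chi 2 j = 1"
      unfolding chi_add[symmetric] by (simp add: chi_eq_1_iff)
    then have "chi 2 j = 1 \<or> chi 2 j = - 1"
      by (simp add: square_eq_1_iff)
    moreover have "exp (- \<i> * of_real (pi / 2)) = - \<i>" "exp (\<i> * of_real (pi / 2)) = \<i>"
      using cis_conv_exp[of "- (pi / 2)", symmetric] cis_conv_exp[of "pi / 2", symmetric] by simp_all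
    ultimately show ?thesis
      by (auto simp: circ_eigenvalue_def S)
  qed
  then show ?thesis
    unfolding pst_between_circulant_iff[OF circulant_quc[OF order_refl]]
    by (intro conjI exI[of _ "pi / 2"] exI[of _ "- \<i>"]) simp_all
qed

lemma pst_4: "pst_between 4 (quc_adj 4) 0 2"
proof -
  have "s = 1 \<or> s = 3" if "s \<in> conn_set 4" for s
  proof -
    have "odd s" "s < 4"
      using conn_set_odd[OF that] that by (simp_all add: conn_set_def)
    then show ?thesis
      by presburger
  qed
  \<comment> \<open>Both use \<open>u = 1\<close>, as 3 is congruent to -1 modulo 4.\<close>
  moreover have "1 \<in> conn_set 4" "3 \<in> conn_set 4"
    by (auto simp: conn_set_def pm_unit_square_def cong_def intro!: exI[of _ 1])
  ultimately have S: "conn_set 4 = {1, 3}"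
    by blast
  \<comment> \<open>For the fourth root of unity \<open>z = chi 4 j\<close> the eigenvalue is
    \<open>z + z ^ 3\<close>: it is 0 if \<open>z ^ 2 = - 1\<close> and \<open>2 * z\<close> if
    \<open>z\<close> is 1 or -1. In each case the exponential is \<open>- (z ^ 2)\<close>, hence the
    phase -1.\<close>
  have "exp (- \<i> * of_real (pi / 2) * quc_eigenvalue 4 j) = - chi 4 (j * 2)" for j
  proof -
    have pow: "chi 4 (j * int m) = chi 4 j ^ m" for m
      using chi_mult_nat[of 4 m j] by (simp add: mult.commute)
    have "chi 4 j ^ 4 = 1"
      unfolding pow[symmetric] by (simp add: chi_eq_1_iff)
    then have "((chi 4 j)\<^sup>2)\<^sup>2 = 1"
      by simp
    then have "(chi 4 j)\<^sup>2 = 1 \<or> (chi 4 j)\<^sup>2 = - 1"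
      by (simp only: power2_eq_1_iff)
    then have "(chi 4 j)\<^sup>2 = - 1 \<or> chi 4 j = 1 \<or> chi 4 j = - 1"
      by (auto simp: power2_eq_1_iff)
    moreover have "quc_eigenvalue 4 j = chi 4 j + chi 4 j * (chi 4 j)\<^sup>2"
      using pow[of 3] by (simp add: circ_eigenvalue_def S power3_eq_cube power2_eq_square)
    moreover have "exp (- (\<i> * of_real pi)) = - 1" "exp (\<i> * of_real pi) = - 1"
      using cis_conv_exp[of "- pi", symmetric] cis_conv_exp[of pi, symmetric]
      by (simp_all add: cis_cnj[symmetric])
    ultimately show ?thesis
      using pow[of 2] by (auto simp: mult.assoc)
  qed
  then show ?thesis
    unfolding pst_between_circulant_iff[OF circulant_quc[of 4, simplified]]
    by (intro conjI exI[of _ "pi / 2"] exI[of _ "- 1"]) simp_all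
qed

theorem theorem4p16:
  fixes n :: nat
  assumes "n > 0"
  shows "admits_pst n (quc_adj n) \<longleftrightarrow> n = 2 \<or> n = 4"
proof
  assume "admits_pst n (quc_adj n)"
  then obtain a b where pst: "pst_between n (quc_adj n) a b"
    by (auto simp: admits_pst_def)
  then have "n \<ge> 2"
    by (auto simp: pst_between_def)
  then show "n = 2 \<or> n = 4"
    using pst by (rule quc_pst_imp_2_or_4)
next
  assume "n = 2 \<or> n = 4"
  then show "admits_pst n (quc_adj n)"
    unfolding admits_pst_def using pst_2 pst_4 by blast
qed

end
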